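(* For every $t\in\mathbb{N}$ and every $\beta=(\beta_2,\beta_3,\dots,\beta_t)\in\mathbb{C}^{t-1}$, the second cohomology group $HL^2(R(F,2,\beta),R(F,2,\beta))$ of the Leibniz algebra $R(F,2,\beta)$ is trivial (i.e. zero).
   Context: A Leibniz algebra is an algebra with bilinear product $[\cdot,\cdot]$ satisfying $[a,[b,c]]=[[a,b],c]-[[a,c],b]$ for all $a,b,c$. $R(F,2,\beta)$ is the Leibniz algebra over $\mathbb{C}$ with basis $\{x,y,e_1,e_2,\dots\}$ (elements are finite linear combinations of basis elements) and products $$[e_i,e_1]=e_{i+1}\ (i\ge 2),\quad [e_1,x]=-[x,e_1]=e_1,\quad [e_i,x]=(i-2)e_i+\sum_{k=2}^{t}\beta_k e_{k+i-2}\ (i\ge 2),\quad [e_i,y]=e_i\ (i\ge 2),$$ all other products of basis elements being zero; empty sums are zero. For a Leibniz algebra $L$, $HL^2(L,L)=ZL^2(L,L)/BL^2(L,L)$, where $ZL^2(L,L)$ is the set of $\varphi\in\mathrm{Hom}(L\otimes L,L)$ with $$[a,\varphi(b,c)]-[\varphi(a,b),c]+[\varphi(a,c),b]+\varphi(a,[b,c])-\varphi([a,b],c)+\varphi([a,c],b)=0\quad\text{for all }a,b,c\in L,$$ and $BL^2(L,L)$ is the set of $\psi\in\mathrm{Hom}(L\otimes L,L)$ for which there exists $f\in\mathrm{Hom}(L,L)$ with $\psi(a,b)=f([a,b])-[f(a),b]-[a,f(b)]$ for all $a,b\in L$. Here $\mathrm{Hom}$ denotes all linear maps. *)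

theory Defs
  imports Complex_Main "HOL-Library.Poly_Mapping" "HOL-Algebra.Elementary_Groups"
begin

section \<open>Leibniz algebras and their second cohomology with adjoint coefficients\<close>

text \<open>
  Linear maps from \<open>L \<otimes> L\<close> to \<open>L\<close> are represented by bilinear maps in curried form.
\<close>

definition bilinear_map :: "('k::field \<Rightarrow> 'a::ab_group_add \<Rightarrow> 'a) \<Rightarrow> ('a \<Rightarrow> 'a \<Rightarrow> 'a) \<Rightarrow> bool" where
  "bilinear_map scale \<phi> \<longleftrightarrow>
     (\<forall>a. Vector_Spaces.linear scale scale (\<phi> a)) \<and>
     (\<forall>b. Vector_Spaces.linear scale scale (\<lambda>a. \<phi> a b))"

locale leibniz_algebra = vector_space scale
  for scale :: "'k::field \<Rightarrow> 'a::ab_group_add \<Rightarrow> 'a" +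
  fixes br :: "'a \<Rightarrow> 'a \<Rightarrow> 'a"
  assumes bilinear: "bilinear_map scale br"
    and leibniz: "br a (br b c) = br (br a b) c - br (br a c) b"

definition ZL2 :: "('k::field \<Rightarrow> 'a::ab_group_add \<Rightarrow> 'a) \<Rightarrow> ('a \<Rightarrow> 'a \<Rightarrow> 'a) \<Rightarrow> ('a \<Rightarrow> 'a \<Rightarrow> 'a) set" where
  "ZL2 scale br = {\<phi>. bilinear_map scale \<phi> \<and>
     (\<forall>a b c. br a (\<phi> b c) - br (\<phi> a b) c + br (\<phi> a c) b
              + \<phi> a (br b c) - \<phi> (br a b) c + \<phi> (br a c) b = 0)}"

definition BL2 :: "('k::field \<Rightarrow> 'a::ab_group_add \<Rightarrow> 'a) \<Rightarrow> ('a \<Rightarrow> 'a \<Rightarrow> 'a) \<Rightarrow> ('a \<Rightarrow> 'a \<Rightarrow> 'a) set" where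
  "BL2 scale br = {\<psi>. bilinear_map scale \<psi> \<and>
     (\<exists>f. Vector_Spaces.linear scale scale f \<and>
          (\<forall>a b. \<psi> a b = f (br a b) - br (f a) b - br a (f b)))}"

definition ZL2_group :: "('k::field \<Rightarrow> 'a::ab_group_add \<Rightarrow> 'a) \<Rightarrow> ('a \<Rightarrow> 'a \<Rightarrow> 'a) \<Rightarrow> ('a \<Rightarrow> 'a \<Rightarrow> 'a) monoid" where
  "ZL2_group scale br =
     \<lparr>carrier = ZL2 scale br, monoid.mult = (\<lambda>\<phi> \<psi> a b. \<phi> a b + \<psi> a b), one = (\<lambda>a b. 0)\<rparr>"

definition HL2 :: "('k::field \<Rightarrow> 'a::ab_group_add \<Rightarrow> 'a) \<Rightarrow> ('a \<Rightarrow> 'a \<Rightarrow> 'a) \<Rightarrow> ('a \<Rightarrow> 'a \<Rightarrow> 'a) set monoid" where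
  "HL2 scale br = ZL2_group scale br Mod BL2 scale br"

lemma linear_mapI:
  assumes "vector_space scale"
    and "\<And>a b. f (a + b) = f a + f b" and "\<And>r a. f (scale r a) = scale r (f a)"
  shows "Vector_Spaces.linear scale scale f"
  using assms by (simp add: linear_iff_module_hom module_hom_iff module_iff_vector_space)

lemma bilinear_mapI:
  assumes "vector_space scale"
    and "\<And>a b c. \<phi> (a + b) c = \<phi> a c + \<phi> b c" and "\<And>a b c. \<phi> a (b + c) = \<phi> a b + \<phi> a c"
    and "\<And>r a b. \<phi> (scale r a) b = scale r (\<phi> a b)" and "\<And>r a b. \<phi> a (scale r b) = scale r (\<phi> a b)"
  shows "bilinear_map scale \<phi>"
  unfolding bilinear_map_def by (auto intro!: linear_mapI assms)

lemma bilinear_mapD: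
  assumes "bilinear_map scale \<phi>"
  shows "\<phi> (a + b) c = \<phi> a c + \<phi> b c" "\<phi> a (b + c) = \<phi> a b + \<phi> a c"
    "\<phi> (scale r a) b = scale r (\<phi> a b)" "\<phi> a (scale r b) = scale r (\<phi> a b)"
    "\<phi> (a - b) c = \<phi> a c - \<phi> b c" "\<phi> a (b - c) = \<phi> a b - \<phi> a c"
    "\<phi> 0 c = 0" "\<phi> a 0 = 0" "\<phi> (- a) b = - \<phi> a b" "\<phi> a (- b) = - \<phi> a b"
proof -
  have l: "Vector_Spaces.linear scale scale (\<lambda>a. \<phi> a b)" and r: "Vector_Spaces.linear scale scale (\<phi> a)"
    for a b using assms by (auto simp: bilinear_map_def)
  have lm: "module_hom scale scale (\<lambda>a. \<phi> a b)" and rm: "module_hom scale scale (\<phi> a)" for a b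
    using l r by (auto simp: linear_iff_module_hom)
  show "\<phi> (a + b) c = \<phi> a c + \<phi> b c" by (rule module_hom.add[OF lm])
  show "\<phi> a (b + c) = \<phi> a b + \<phi> a c" by (rule module_hom.add[OF rm])
  show "\<phi> (scale r a) b = scale r (\<phi> a b)" by (rule module_hom.scale[OF lm])
  show "\<phi> a (scale r b) = scale r (\<phi> a b)" by (rule module_hom.scale[OF rm])
  show "\<phi> (a - b) c = \<phi> a c - \<phi> b c" by (rule module_hom.diff[OF lm])
  show "\<phi> a (b - c) = \<phi> a b - \<phi> a c" by (rule module_hom.diff[OF rm])
  show "\<phi> 0 c = 0" by (rule module_hom.zero[OF lm])
  show "\<phi> a 0 = 0" by (rule module_hom.zero[OF rm])
  show "\<phi> (- a) b = - \<phi> a b" by (rule module_hom.neg[OF lm])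
  show "\<phi> a (- b) = - \<phi> a b" by (rule module_hom.neg[OF rm])
qed

context leibniz_algebra
begin

lemma comm_group_ZL2: "comm_group (ZL2_group scale br)"
proof (rule comm_groupI, goal_cases)
  case (1 \<phi> \<psi>)
  have b: "bilinear_map scale \<phi>" "bilinear_map scale \<psi>" using 1 by (auto simp: ZL2_group_def ZL2_def)
  have "bilinear_map scale (\<lambda>a b. \<phi> a b + \<psi> a b)"
    by (rule bilinear_mapI[OF vector_space_axioms])
      (simp_all add: bilinear_mapD[OF b(1)] bilinear_mapD[OF b(2)] scale_right_distrib algebra_simps)
  moreover have "br a (\<phi> b c + \<psi> b c) - br (\<phi> a b + \<psi> a b) c + br (\<phi> a c + \<psi> a c) b
     + (\<phi> a (br b c) + \<psi> a (br b c)) - (\<phi> (br a b) c + \<psi> (br a b) c) + (\<phi> (br a c) b + \<psi> (br a c) b)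
     = 0" (is "?l = 0") for a b c
  proof -
    have "?l = (br a (\<phi> b c) - br (\<phi> a b) c + br (\<phi> a c) b
              + \<phi> a (br b c) - \<phi> (br a b) c + \<phi> (br a c) b)
            + (br a (\<psi> b c) - br (\<psi> a b) c + br (\<psi> a c) b
              + \<psi> a (br b c) - \<psi> (br a b) c + \<psi> (br a c) b)"
      by (simp add: bilinear_mapD[OF bilinear] algebra_simps)
    also have "\<dots> = 0 + 0" using 1 by (simp only: ZL2_group_def ZL2_def) simp
    finally show ?thesis by simp
  qed
  ultimately show ?case by (simp add: ZL2_group_def ZL2_def)
next
  case 2
  show ?case
    by (auto simp: ZL2_group_def ZL2_def bilinear_mapD[OF bilinear]
        intro!: bilinear_mapI[OF vector_space_axioms])
next
  case (6 \<phi>)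
  have b: "bilinear_map scale \<phi>" using 6 by (auto simp: ZL2_group_def ZL2_def)
  have "bilinear_map scale (\<lambda>a b. - \<phi> a b)"
    by (rule bilinear_mapI[OF vector_space_axioms]) (simp_all add: bilinear_mapD[OF b])
  moreover have "br a (- \<phi> b c) - br (- \<phi> a b) c + br (- \<phi> a c) b
     + (- \<phi> a (br b c)) - (- \<phi> (br a b) c) + (- \<phi> (br a c) b) = 0" (is "?l = 0") for a b c
  proof -
    have "?l = - (br a (\<phi> b c) - br (\<phi> a b) c + br (\<phi> a c) b
              + \<phi> a (br b c) - \<phi> (br a b) c + \<phi> (br a c) b)"
      by (simp add: bilinear_mapD[OF bilinear])
    also have "\<dots> = - 0" using 6 by (simp only: ZL2_group_def ZL2_def) simp
    finally show ?thesis by simp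
  qed
  ultimately have "(\<lambda>a b. - \<phi> a b) \<in> ZL2 scale br" by (simp add: ZL2_def)
  then show ?case by (intro bexI[of _ "\<lambda>a b. - \<phi> a b"]) (auto simp: ZL2_group_def)
qed (auto simp: ZL2_group_def fun_eq_iff algebra_simps)

lemma coboundary_in_ZL2:
  assumes "Vector_Spaces.linear scale scale f"
  shows "(\<lambda>a b. f (br a b) - br (f a) b - br a (f b)) \<in> ZL2 scale br"
proof -
  have m: "module_hom scale scale f" using assms by (simp add: linear_iff_module_hom)
  note f = module_hom.add[OF m] module_hom.scale[OF m] module_hom.diff[OF m]
  note B = bilinear_mapD[OF bilinear]
  have "bilinear_map scale (\<lambda>a b. f (br a b) - br (f a) b - br a (f b))"
    by (rule bilinear_mapI[OF vector_space_axioms])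
      (simp_all add: B f scale_right_diff_distrib algebra_simps)
  moreover have "br a (f (br b c) - br (f b) c - br b (f c))
    - br (f (br a b) - br (f a) b - br a (f b)) c
    + br (f (br a c) - br (f a) c - br a (f c)) b
    + (f (br a (br b c)) - br (f a) (br b c) - br a (f (br b c)))
    - (f (br (br a b) c) - br (f (br a b)) c - br (br a b) (f c))
    + (f (br (br a c) b) - br (f (br a c)) b - br (br a c) (f b)) = 0" for a b c
    by (simp add: B f leibniz[of a b c] leibniz[of "f a" b c] leibniz[of a "f b" c]
        leibniz[of a b "f c"])
  ultimately show ?thesis by (simp add: ZL2_def)
qed

lemma subgroup_BL2: "subgroup (BL2 scale br) (ZL2_group scale br)"
proof -
  interpret Z: comm_group "ZL2_group scale br" by (rule comm_group_ZL2)
  interpret P: vector_space_pair scale scale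
    using vector_space_axioms by (simp add: vector_space_pair_def)
  note B = bilinear_mapD[OF bilinear]
  have sub: "BL2 scale br \<subseteq> ZL2 scale br"
  proof
    fix \<psi> assume "\<psi> \<in> BL2 scale br"
    then obtain f where f: "Vector_Spaces.linear scale scale f"
      "\<And>a b. \<psi> a b = f (br a b) - br (f a) b - br a (f b)" by (auto simp: BL2_def)
    have "\<psi> = (\<lambda>a b. f (br a b) - br (f a) b - br a (f b))" using f(2) by (intro ext)
    with coboundary_in_ZL2[OF f(1)] show "\<psi> \<in> ZL2 scale br" by simp
  qed
  have memI: "\<psi> \<in> BL2 scale br" if "Vector_Spaces.linear scale scale f"
    "\<psi> = (\<lambda>a b. f (br a b) - br (f a) b - br a (f b))" for f \<psi>
    using coboundary_in_ZL2[OF that(1)] that by (auto simp: BL2_def ZL2_def)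
  show ?thesis
  proof (rule Z.subgroupI)
    show "BL2 scale br \<subseteq> carrier (ZL2_group scale br)" using sub by (simp add: ZL2_group_def)
    have "(\<lambda>a b. 0) \<in> BL2 scale br"
      by (rule memI[of "\<lambda>a. 0"]) (auto simp: B intro!: linear_mapI[OF vector_space_axioms])
    then show "BL2 scale br \<noteq> {}" by blast
  next
    fix \<psi> assume p: "\<psi> \<in> BL2 scale br"
    then obtain f where f: "Vector_Spaces.linear scale scale f"
      "\<And>a b. \<psi> a b = f (br a b) - br (f a) b - br a (f b)" by (auto simp: BL2_def)
    have "(\<lambda>a b. - \<psi> a b) \<in> BL2 scale br"
      by (rule memI[of "\<lambda>a. - f a"])
        (use f in \<open>auto simp: B fun_eq_iff intro: P.linear_compose_neg\<close>)
    moreover have "inv\<^bsub>ZL2_group scale br\<^esub> \<psi> = (\<lambda>a b. - \<psi> a b)"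
      by (rule Z.inv_equality) (use p sub calculation in \<open>auto simp: ZL2_group_def\<close>)
    ultimately show "inv\<^bsub>ZL2_group scale br\<^esub> \<psi> \<in> BL2 scale br" by simp
  next
    fix \<psi> \<chi> assume "\<psi> \<in> BL2 scale br" "\<chi> \<in> BL2 scale br"
    then obtain f g where f: "Vector_Spaces.linear scale scale f"
      "\<And>a b. \<psi> a b = f (br a b) - br (f a) b - br a (f b)"
      and g: "Vector_Spaces.linear scale scale g"
      "\<And>a b. \<chi> a b = g (br a b) - br (g a) b - br a (g b)" by (auto simp: BL2_def)
    have "(\<lambda>a b. \<psi> a b + \<chi> a b) \<in> BL2 scale br"
      by (rule memI[OF P.linear_compose_add[OF f(1) g(1)]])
        (auto simp: B fun_eq_iff f(2) g(2) algebra_simps)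
    then show "\<psi> \<otimes>\<^bsub>ZL2_group scale br\<^esub> \<chi> \<in> BL2 scale br" by (simp add: ZL2_group_def)
  qed
qed

lemma group_HL2: "group (HL2 scale br)"
  unfolding HL2_def
  by (intro normal.factorgroup_is_group comm_group.subgroup_imp_normal comm_group_ZL2 subgroup_BL2)

end


section \<open>The algebra \<open>R(F,2,\<beta>)\<close>\<close>

text \<open>\<open>E n\<close> labels the basis vector \<open>e\<^sub>n\<^sub>+\<^sub>1\<close>, so that the labels are exactly \<open>x, y, e\<^sub>1, e\<^sub>2, \<dots>\<close>.\<close>

datatype gen = X | Y | E nat

type_synonym rvec = "gen \<Rightarrow>\<^sub>0 complex"

definition cscale :: "complex \<Rightarrow> rvec \<Rightarrow> rvec" where
  "cscale c p = Poly_Mapping.map (\<lambda>z. c * z) p"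

definition rx :: rvec where "rx = Poly_Mapping.single X 1"

definition ry :: rvec where "ry = Poly_Mapping.single Y 1"

text \<open>Only meaningful for \<open>i \<ge> 1\<close>.\<close>

definition re :: "nat \<Rightarrow> rvec" where "re i = Poly_Mapping.single (E (i - 1)) 1"

text \<open>
  The products of basis vectors; \<open>E (Suc n)\<close> is \<open>e\<^sub>i\<close> with \<open>i = n + 2\<close>. See the lemma
  \<open>rbr_table\<close> below for the table in the usual indexing. Only \<open>\<beta> 2, \<dots>, \<beta> t\<close> are used.
\<close>

fun gen_br :: "nat \<Rightarrow> (nat \<Rightarrow> complex) \<Rightarrow> gen \<Rightarrow> gen \<Rightarrow> rvec" where
  "gen_br t \<beta> (E (Suc n)) (E 0) = re (n + 3)"
| "gen_br t \<beta> (E 0) X = re 1"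
| "gen_br t \<beta> X (E 0) = - re 1"
| "gen_br t \<beta> (E (Suc n)) X = cscale (of_nat n) (re (n + 2)) + (\<Sum>k=2..t. cscale (\<beta> k) (re (k + n)))"
| "gen_br t \<beta> (E (Suc n)) Y = re (n + 2)"
| "gen_br t \<beta> _ _ = 0"

definition rbr :: "nat \<Rightarrow> (nat \<Rightarrow> complex) \<Rightarrow> rvec \<Rightarrow> rvec \<Rightarrow> rvec" where
  "rbr t \<beta> p q = (\<Sum>g\<in>Poly_Mapping.keys p. \<Sum>h\<in>Poly_Mapping.keys q.
     cscale (Poly_Mapping.lookup p g * Poly_Mapping.lookup q h) (gen_br t \<beta> g h))"

lemma lookup_cscale [simp]: "Poly_Mapping.lookup (cscale c p) g = c * Poly_Mapping.lookup p g"
  by (simp add: cscale_def Poly_Mapping.map.rep_eq when_def)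

lemma vector_space_cscale: "vector_space cscale"
  by unfold_locales (auto intro!: poly_mapping_eqI simp: lookup_add algebra_simps)

interpretation rvec: vector_space cscale by (rule vector_space_cscale)

interpretation rvec: vector_space_pair cscale cscale by unfold_locales

definition lin_ext :: "(gen \<Rightarrow> rvec) \<Rightarrow> rvec \<Rightarrow> rvec" where
  "lin_ext F p = (\<Sum>g\<in>Poly_Mapping.keys p. cscale (Poly_Mapping.lookup p g) (F g))"

lemma lin_ext_superset:
  assumes "finite S" "Poly_Mapping.keys p \<subseteq> S"
  shows "lin_ext F p = (\<Sum>g\<in>S. cscale (Poly_Mapping.lookup p g) (F g))"
  unfolding lin_ext_def
  by (rule sum.mono_neutral_left) (use assms in \<open>auto simp: in_keys_iff\<close>)

lemma lin_ext_add: "lin_ext F (p + q) = lin_ext F p + lin_ext F q"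
proof -
  let ?S = "Poly_Mapping.keys p \<union> Poly_Mapping.keys q"
  have "Poly_Mapping.keys (p + q) \<subseteq> ?S" by (rule Poly_Mapping.keys_add)
  then show ?thesis
    by (simp add: lin_ext_superset[of ?S] lookup_add rvec.scale_left_distrib sum.distrib)
qed

lemma lin_ext_scale: "lin_ext F (cscale c p) = cscale c (lin_ext F p)"
proof -
  have "Poly_Mapping.keys (cscale c p) \<subseteq> Poly_Mapping.keys p" by (auto simp: in_keys_iff)
  then show ?thesis
    by (simp add: lin_ext_superset[of "Poly_Mapping.keys p"] rvec.scale_sum_right)
qed

lemma lin_ext_single [simp]: "lin_ext F (Poly_Mapping.single g 1) = F g"
  by (simp add: lin_ext_def)

lemma lin_ext_linear_eq:
  assumes "Vector_Spaces.linear cscale cscale f"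
  shows "f p = lin_ext (\<lambda>g. f (Poly_Mapping.single g 1)) p"
proof -
  have "p = (\<Sum>g\<in>Poly_Mapping.keys p. cscale (Poly_Mapping.lookup p g) (Poly_Mapping.single g 1))"
    by (rule poly_mapping_eqI)
      (auto simp: lookup_sum lookup_single when_def in_keys_iff if_distrib sum.delta cong: if_cong)
  then have "f p = f (\<Sum>g\<in>Poly_Mapping.keys p. cscale (Poly_Mapping.lookup p g) (Poly_Mapping.single g 1))"
    by simp
  also have "\<dots> = lin_ext (\<lambda>g. f (Poly_Mapping.single g 1)) p"
    unfolding lin_ext_def
    by (simp add: rvec.linear_sum[OF assms] rvec.linear_scale[OF assms])
  finally show ?thesis .
qed

lemma linear_eqI:
  assumes "Vector_Spaces.linear cscale cscale f" "Vector_Spaces.linear cscale cscale f'"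
    and "\<And>g. f (Poly_Mapping.single g 1) = f' (Poly_Mapping.single g 1)"
  shows "f p = f' p"
proof -
  have "f p = lin_ext (\<lambda>g. f (Poly_Mapping.single g 1)) p" by (rule lin_ext_linear_eq[OF assms(1)])
  also have "\<dots> = lin_ext (\<lambda>g. f' (Poly_Mapping.single g 1)) p" by (simp only: assms(3))
  also have "\<dots> = f' p" by (rule lin_ext_linear_eq[OF assms(2), symmetric])
  finally show ?thesis .
qed

lemma rbr_eq1: "rbr t \<beta> p q = lin_ext (\<lambda>g. lin_ext (gen_br t \<beta> g) q) p"
  by (simp add: rbr_def lin_ext_def rvec.scale_sum_right)

lemma rbr_eq2: "rbr t \<beta> p q = lin_ext (\<lambda>h. lin_ext (\<lambda>g. gen_br t \<beta> g h) p) q"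
  unfolding rbr_def lin_ext_def by (subst sum.swap) (simp add: rvec.scale_sum_right mult.commute)

lemma bilinear_rbr: "bilinear_map cscale (rbr t \<beta>)"
proof (rule bilinear_mapI[OF vector_space_cscale])
  show "rbr t \<beta> (a + b) c = rbr t \<beta> a c + rbr t \<beta> b c" for a b c by (simp add: rbr_eq1 lin_ext_add)
  show "rbr t \<beta> a (b + c) = rbr t \<beta> a b + rbr t \<beta> a c" for a b c by (simp add: rbr_eq2 lin_ext_add)
  show "rbr t \<beta> (cscale r a) b = cscale r (rbr t \<beta> a b)" for r a b by (simp add: rbr_eq1 lin_ext_scale)
  show "rbr t \<beta> a (cscale r b) = cscale r (rbr t \<beta> a b)" for r a b by (simp add: rbr_eq2 lin_ext_scale)
qed

lemma rbr_single [simp]: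
  "rbr t \<beta> (Poly_Mapping.single g 1) (Poly_Mapping.single h 1) = gen_br t \<beta> g h"
  by (simp add: rbr_eq1)

lemma rbr_table:
  "i \<ge> 2 \<Longrightarrow> rbr t \<beta> (re i) (re 1) = re (i + 1)"
  "rbr t \<beta> (re 1) rx = re 1"
  "rbr t \<beta> rx (re 1) = - re 1"
  "i \<ge> 2 \<Longrightarrow> rbr t \<beta> (re i) rx
     = cscale (of_nat (i - 2)) (re i) + (\<Sum>k=2..t. cscale (\<beta> k) (re (k + i - 2)))"
  "i \<ge> 2 \<Longrightarrow> rbr t \<beta> (re i) ry = re i"
  "j \<ge> 2 \<Longrightarrow> rbr t \<beta> p (re j) = 0"
  "rbr t \<beta> (re 1) (re 1) = 0" "rbr t \<beta> (re 1) ry = 0"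
  "rbr t \<beta> rx rx = 0" "rbr t \<beta> rx ry = 0"
  "rbr t \<beta> ry rx = 0" "rbr t \<beta> ry ry = 0" "rbr t \<beta> ry (re 1) = 0"
proof -
  have *: "\<exists>n. i - 1 = Suc n \<and> i = n + 2" if "i \<ge> 2" for i :: nat
    using that by (intro exI[of _ "i - 2"]) auto
  show "rbr t \<beta> (re i) (re 1) = re (i + 1)" if "i \<ge> 2"
    using *[OF that] by (auto simp: re_def)
  show "rbr t \<beta> (re i) rx
     = cscale (of_nat (i - 2)) (re i) + (\<Sum>k=2..t. cscale (\<beta> k) (re (k + i - 2)))" if "i \<ge> 2"
    using *[OF that] by (auto simp: re_def rx_def)
  show "rbr t \<beta> (re i) ry = re i" if "i \<ge> 2" using *[OF that] by (auto simp: re_def ry_def)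
  show "rbr t \<beta> p (re j) = 0" if "j \<ge> 2"
  proof -
    have n: "j - 1 = Suc (j - 2)" using that by simp
    have "gen_br t \<beta> g (E (Suc n)) = 0" for g n by (cases g rule: gen.exhaust) auto
    then show ?thesis unfolding rbr_eq1 re_def n lin_ext_single by (simp add: lin_ext_def)
  qed
qed (simp_all add: re_def rx_def ry_def)

lemma rbr_leibniz:
  "rbr t \<beta> a (rbr t \<beta> b c) = rbr t \<beta> (rbr t \<beta> a b) c - rbr t \<beta> (rbr t \<beta> a c) b"
proof -
  let ?B = "rbr t \<beta>" and ?s = "\<lambda>g. Poly_Mapping.single g 1 :: rvec"
  note B = bilinear_mapD[OF bilinear_rbr]
  have basis: "?B (?s g) (?B (?s h) (?s k)) = ?B (?B (?s g) (?s h)) (?s k) - ?B (?B (?s g) (?s k)) (?s h)"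
    for g h k
  proof -
    define v where "v n = ?s (E (Suc n))" for n
    define w where "w = ?s (E 0)"
    define X' where "X' = ?s X"
    define Y' where "Y' = ?s Y"
    have re_v: "re (n + 2) = v n" "re (n + 3) = v (Suc n)" "re 1 = w" for n
      by (simp_all add: re_def v_def w_def numeral_3_eq_3)
    have sum_v: "(\<Sum>k=2..t. cscale (\<beta> k) (re (k + n))) = (\<Sum>k=2..t. cscale (\<beta> k) (v (k - 2 + n)))" for n
    proof (rule sum.cong[OF refl])
      fix k assume "k \<in> {2..t}"
      then have "k + n = k - 2 + n + 2" unfolding atLeastAtMost_iff by linarith
      then show "cscale (\<beta> k) (re (k + n)) = cscale (\<beta> k) (v (k - 2 + n))" by (metis re_v(1))
    qed
    have tab: "?B (v n) w = v (Suc n)" "?B w X' = w" "?B X' w = - w"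
      "?B (v n) X' = cscale (of_nat n) (v n) + (\<Sum>k=2..t. cscale (\<beta> k) (v (k - 2 + n)))"
      "?B (v n) Y' = v n" "?B w w = 0" "?B w Y' = 0" "?B X' X' = 0" "?B X' Y' = 0"
      "?B Y' X' = 0" "?B Y' Y' = 0" "?B Y' w = 0" for n
      unfolding v_def w_def X'_def Y'_def rbr_single
      by (simp_all only: gen_br.simps re_v sum_v flip: v_def w_def)
    have z: "?B p (v n) = 0" for p n
    proof -
      have "gen_br t \<beta> g (E (Suc n)) = 0" for g by (cases g rule: gen.exhaust) auto
      then show ?thesis unfolding rbr_eq1 v_def lin_ext_single by (simp add: lin_ext_def)
    qed
    have S1: "?B (sum f S) q = (\<Sum>k\<in>S. ?B (f k) q)"
      and S2: "?B q (sum f S) = (\<Sum>k\<in>S. ?B q (f k))" for f :: "nat \<Rightarrow> rvec" and S q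
      by (induction S rule: infinite_finite_induct) (simp_all add: B)
    have cases: "?s g \<in> {X', Y', w} \<or> (\<exists>n. ?s g = v n)" for g
    proof (cases g)
      case (E n) then show ?thesis by (cases n) (auto simp: v_def w_def)
    qed (auto simp: X'_def Y'_def)
    have "?B a (?B b c) = ?B (?B a b) c - ?B (?B a c) b"
      if "a \<in> {X', Y', w} \<or> (\<exists>n. a = v n)" "b \<in> {X', Y', w} \<or> (\<exists>n. b = v n)"
        "c \<in> {X', Y', w} \<or> (\<exists>n. c = v n)" for a b c
      using that
      by (elim disjE exE insertE emptyE; hypsubst;
          simp add: tab z B S1 S2 rvec.scale_left_distrib add.commute)
    from this[OF cases cases cases] show ?thesis .
  qed
  note lin = linear_mapI[OF vector_space_cscale] and L = B rvec.scale_right_diff_distrib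
  have 1: "?B (?s g) (?B (?s h) c) = ?B (?B (?s g) (?s h)) c - ?B (?B (?s g) c) (?s h)" for g h c
    by (rule linear_eqI[where f = "\<lambda>c. ?B (?s g) (?B (?s h) c)"
          and f' = "\<lambda>c. ?B (?B (?s g) (?s h)) c - ?B (?B (?s g) c) (?s h)"])
      ((intro lin; simp add: L)+, rule basis)
  have 2: "?B (?s g) (?B b c) = ?B (?B (?s g) b) c - ?B (?B (?s g) c) b" for g b c
    by (rule linear_eqI[where f = "\<lambda>b. ?B (?s g) (?B b c)"
          and f' = "\<lambda>b. ?B (?B (?s g) b) c - ?B (?B (?s g) c) b"])
      ((intro lin; simp add: L)+, rule 1)
  show ?thesis
    by (rule linear_eqI[where f = "\<lambda>a. ?B a (?B b c)"
          and f' = "\<lambda>a. ?B (?B a b) c - ?B (?B a c) b"])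
      ((intro lin; simp add: L)+, rule 2)
qed

lemma leibniz_algebra_rbr: "leibniz_algebra cscale (rbr t \<beta>)"
  by (intro leibniz_algebra.intro leibniz_algebra_axioms.intro vector_space_cscale bilinear_rbr rbr_leibniz)

end

theory Submission
  imports Defs
begin

text \<open>
  Write \<open>V\<close> for the span of \<open>e\<^sub>2, e\<^sub>3, \<dots>\<close> and \<open>g\<close> for the span of \<open>x, y, e\<^sub>1\<close>. Identify \<open>e\<^sub>n\<^sub>+\<^sub>2\<close>
  with the monomial \<open>z\<^sup>n\<close>, so that \<open>V\<close> is the space of polynomials in \<open>z\<close>. Then \<open>g\<close> is a Lie
  algebra with \<open>y\<close> central, \<open>[L, V] = 0\<close>, and right multiplication makes \<open>V\<close> a \<open>g\<close>-module:
  \<open>y\<close> acts as the identity, \<open>e\<^sub>1\<close> as multiplication by \<open>z\<close>, and \<open>x\<close> as the Euler operator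
  \<open>z d/dz\<close> plus multiplication by \<open>b = \<Sum>\<^sub>k \<beta>\<^sub>k z\<^sup>k\<^sup>-\<^sup>2\<close>. An operator on \<open>V\<close> that commutes with \<open>z\<close>
  commutes with \<open>b\<close> too, so \<open>\<beta>\<close> drops out of every commutator that matters
  (\<open>commutator_x_v0\<close>), and the answer does not depend on \<open>\<beta>\<close>.

  Let \<open>\<phi>\<close> be a 2-cocycle. The derivation \<open>D = [\<cdot>, y]\<close> is the projection onto \<open>V\<close> along \<open>g\<close>, and
  an inner derivation acts trivially on cohomology; hence a coboundary moves \<open>\<phi>\<close> to weight zero
  (\<open>reduce_to_weight_zero\<close>), where \<open>\<phi>(g, g) \<subseteq> g\<close>, \<open>\<phi>(V, g) \<subseteq> V\<close> and \<open>\<phi>(L, V) = 0\<close>. What is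
  left is the restriction of \<open>\<phi>\<close> to \<open>g\<close> and the operators \<open>A\<^sub>b = \<phi>(\<cdot>, b)\<close> on \<open>V\<close> for \<open>b \<in> g\<close>.

  The action of \<open>g\<close> on \<open>V\<close> is faithful, which forces \<open>\<phi>\<close> to be alternating on \<open>g\<close>
  (\<open>weight_zero_diagonal\<close>): the symmetric cocycles of \<open>g\<close> disappear. The Lie algebra \<open>g\<close> still
  has one nontrivial class, \<open>\<phi>(x, y) = a y\<close>. A further coboundary leaves only this class and
  makes \<open>A\<close> vanish at \<open>e\<^sub>1\<close> (\<open>kill_w_components\<close>). The operators \<open>A\<^sub>x\<close> and \<open>A\<^sub>y\<close> then commute with
  \<open>z\<close>, that is, they are multiplications by polynomials. The cocycle identity at \<open>x, y\<close> reads
  \<open>z A\<^sub>y' = - a\<close>, and comparing constant terms gives \<open>a = 0\<close> and \<open>A\<^sub>y\<close> constant. Finally the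
  multiplications by polynomials \<open>p\<close> on \<open>V\<close> change \<open>A\<^sub>x\<close> by \<open>z p'\<close>, an arbitrary polynomial
  without constant term, and the two remaining constants are removed by the derivations of \<open>g\<close>
  into its centre (\<open>normalized_in_BL2\<close>).
\<close>

section \<open>The basis and linear maps prescribed on it\<close>

abbreviation coord :: "rvec \<Rightarrow> gen \<Rightarrow> complex" where "coord \<equiv> Poly_Mapping.lookup"

text \<open>
  In the notation of the outline, \<open>w\<close> is \<open>e\<^sub>1\<close> and \<open>v n\<close> is the monomial \<open>z\<^sup>n\<close>.
\<close>

definition w :: rvec where "w = re 1"

definition v :: "nat \<Rightarrow> rvec" where "v n = re (n + 2)"

lemma lookup_basis [simp]:
  "coord rx X = 1" "coord rx Y = 0" "coord rx (E n) = 0"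
  "coord ry X = 0" "coord ry Y = 1" "coord ry (E n) = 0"
  "coord w X = 0" "coord w Y = 0" "coord w (E n) = (if n = 0 then 1 else 0)"
  "coord (v m) X = 0" "coord (v m) Y = 0" "coord (v m) (E n) = (if n = Suc m then 1 else 0)"
  by (auto simp: rx_def ry_def w_def v_def re_def lookup_single when_def)

abbreviation lin :: "(rvec \<Rightarrow> rvec) \<Rightarrow> bool" where
  "lin \<equiv> Vector_Spaces.linear cscale cscale"

lemmas linI = linear_mapI[OF vector_space_cscale]

lemma linD:
  assumes "lin f"
  shows "f (a + b) = f a + f b" "f (a - b) = f a - f b" "f (cscale c a) = cscale c (f a)"
    "f 0 = 0" "f (- a) = - f a" "f (sum h S) = (\<Sum>i\<in>S. f (h i))"
  by (simp_all add: rvec.linear_add[OF assms] rvec.linear_diff[OF assms] rvec.linear_scale[OF assms]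
      rvec.linear_0[OF assms] rvec.linear_neg[OF assms] rvec.linear_sum[OF assms])

lemma basis_cases:
  obtains "Poly_Mapping.single g 1 = rx" | "Poly_Mapping.single g 1 = ry"
    | "Poly_Mapping.single g 1 = w" | n where "Poly_Mapping.single g 1 = v n"
proof (cases g)
  case (E n) then show ?thesis using that by (cases n) (auto simp: w_def v_def re_def)
qed (use that in \<open>auto simp: rx_def ry_def\<close>)

lemma lin_eq_on_basis:
  assumes "lin f" "lin f'" "f rx = f' rx" "f ry = f' ry" "f w = f' w" "\<And>n. f (v n) = f' (v n)"
  shows "f p = f' p"
proof (rule linear_eqI[OF assms(1,2)])
  fix g show "f (Poly_Mapping.single g 1) = f' (Poly_Mapping.single g 1)"
    by (cases g rule: basis_cases) (simp_all add: assms)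
qed

definition basis_ext :: "rvec \<Rightarrow> rvec \<Rightarrow> rvec \<Rightarrow> (nat \<Rightarrow> rvec) \<Rightarrow> rvec \<Rightarrow> rvec" where
  "basis_ext a b c u =
     lin_ext (\<lambda>g. case g of X \<Rightarrow> a | Y \<Rightarrow> b | E n \<Rightarrow> (case n of 0 \<Rightarrow> c | Suc m \<Rightarrow> u m))"

lemma lin_basis_ext: "lin (basis_ext a b c u)"
  by (rule linI) (simp_all add: basis_ext_def lin_ext_add lin_ext_scale)

lemma basis_ext_simps [simp]:
  "basis_ext a b c u rx = a" "basis_ext a b c u ry = b"
  "basis_ext a b c u w = c" "basis_ext a b c u (v n) = u n"
  by (simp_all add: basis_ext_def rx_def ry_def w_def v_def re_def)

section \<open>The product seen as operators on polynomials\<close>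

context
  fixes t :: nat and \<beta> :: "nat \<Rightarrow> complex"
begin

abbreviation br (infixl "\<bullet>" 75) where "a \<bullet> b \<equiv> rbr t \<beta> a b"

abbreviation D where "D a \<equiv> a \<bullet> ry"

text \<open>
  Multiplication by the polynomial \<open>b\<close>, written through multiplication by \<open>z\<close> so that it visibly
  commutes with everything that commutes with \<open>z\<close>.
\<close>

definition mult_b :: "rvec \<Rightarrow> rvec" where
  "mult_b p = (\<Sum>k=2..t. cscale (\<beta> k) (((\<lambda>q. q \<bullet> w) ^^ (k - 2)) p))"

definition euler :: "rvec \<Rightarrow> rvec" where
  "euler = basis_ext 0 0 0 (\<lambda>n. cscale (of_nat n) (v n))"

text \<open>
  The inverse of the Euler operator on polynomials without constant term. The coefficient at
  \<open>n = 0\<close> is \<open>1 / 0 = 0\<close>, so constants are sent to zero.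
\<close>

definition anti_euler :: "rvec \<Rightarrow> rvec" where
  "anti_euler = basis_ext 0 0 0 (\<lambda>n. cscale (1 / of_nat n) (v n))"

lemmas br_lin [simp] = bilinear_mapD[OF bilinear_rbr]

lemma br_right_v [simp]: "a \<bullet> v n = 0"
  by (simp add: v_def rbr_table(6))

lemma v_br_w [simp]: "v n \<bullet> w = v (Suc n)"
  using rbr_table(1)[of "n + 2" t \<beta>] by (simp add: v_def w_def)

lemma v_br_y [simp]: "D (v n) = v n"
  using rbr_table(5)[of "n + 2" t \<beta>] by (simp add: v_def)

lemma br_g [simp]:
  "w \<bullet> rx = w" "rx \<bullet> w = - w" "w \<bullet> w = 0" "D w = 0" "rx \<bullet> rx = 0" "D rx = 0"
  "ry \<bullet> rx = 0" "D ry = 0" "ry \<bullet> w = 0"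
  using rbr_table(2,3,7-13)[of t \<beta>] by (simp_all add: w_def)

lemma pow_w_v: "((\<lambda>q. q \<bullet> w) ^^ m) (v n) = v (m + n)"
  by (induction m) simp_all

lemma v_br_x: "v n \<bullet> rx = cscale (of_nat n) (v n) + mult_b (v n)"
proof -
  have "(\<Sum>k=2..t. cscale (\<beta> k) (re (k + (n + 2) - 2))) = mult_b (v n)"
    unfolding mult_b_def pow_w_v
  proof (rule sum.cong[OF refl])
    fix k assume "k \<in> {2..t}"
    then have "k + (n + 2) - 2 = k - 2 + n + 2" by auto
    then show "cscale (\<beta> k) (re (k + (n + 2) - 2)) = cscale (\<beta> k) (v (k - 2 + n))"
      by (simp only: v_def)
  qed
  then show ?thesis
    using rbr_table(4)[of "n + 2" t \<beta>] by (simp add: v_def)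
qed

lemma lin_pow_w: "lin ((\<lambda>q. q \<bullet> w) ^^ m)"
proof (rule linI)
  show "((\<lambda>q. q \<bullet> w) ^^ m) (a + b) = ((\<lambda>q. q \<bullet> w) ^^ m) a + ((\<lambda>q. q \<bullet> w) ^^ m) b" for a b
    by (induction m) simp_all
  show "((\<lambda>q. q \<bullet> w) ^^ m) (cscale r a) = cscale r (((\<lambda>q. q \<bullet> w) ^^ m) a)" for r a
    by (induction m) simp_all
qed

lemma lin_mult_b: "lin mult_b"
  by (rule linI) (simp_all add: mult_b_def linD[OF lin_pow_w] sum.distrib rvec.scale_right_distrib
      rvec.scale_sum_right rvec.scale_left_commute mult.commute)

lemma lin_br: "lin (\<lambda>a. a \<bullet> b)" "lin (\<lambda>b. a \<bullet> b)"
  by (rule linI; simp)+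

lemma br_D [simp]: "a \<bullet> D b = 0"
  by (rule lin_eq_on_basis[where f = "\<lambda>b. a \<bullet> D b" and f' = "\<lambda>_. 0"]) (auto intro!: linI)

lemma D_D [simp]: "D (D a) = D a"
  by (rule lin_eq_on_basis[where f = "\<lambda>a. D (D a)"]) (auto intro!: linI)

text \<open>
  \<open>D\<close> is a derivation, but the second term of the Leibniz rule vanishes because the right factor
  \<open>D b\<close> lies in \<open>V\<close>.
\<close>

lemma D_br: "D (a \<bullet> b) = D a \<bullet> b"
  using rbr_leibniz[of t \<beta> a b ry] by simp

lemma v_nonzero [simp]: "v n \<noteq> 0"
proof
  assume "v n = 0"
  then have "coord (v n) (E (Suc n)) = 0" by (simp only: lookup_zero)
  then show False by simp
qed

text \<open>
  In particular \<open>D p = 0\<close> characterises the elements of \<open>g\<close>, and \<open>D p = p\<close> those of \<open>V\<close>.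
\<close>

lemma decompose:
  "p = cscale (coord p X) rx + cscale (coord p Y) ry + cscale (coord p (E 0)) w + D p"
  by (rule lin_eq_on_basis[where f = "\<lambda>p. p" and f' = "\<lambda>p. cscale (coord p X) rx
     + cscale (coord p Y) ry + cscale (coord p (E 0)) w + D p"])
    (auto intro!: linI simp: lookup_add rvec.scale_left_distrib rvec.scale_right_distrib)

lemma V_br_x: "D p \<bullet> rx = euler p + mult_b (D p)"
  by (rule lin_eq_on_basis[where f = "\<lambda>p. D p \<bullet> rx" and f' = "\<lambda>p. euler p + mult_b (D p)"])
    (auto intro!: linI simp: linD[OF lin_mult_b] linD[OF lin_basis_ext] euler_def v_br_x
      rvec.scale_right_distrib)

lemma euler_inverse:
  "euler (anti_euler p) = D p - cscale (coord p (E 1)) (v 0)"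
  "anti_euler (euler p) = D p - cscale (coord p (E 1)) (v 0)"
proof -
  have "lin euler" "lin anti_euler" by (simp_all add: euler_def anti_euler_def lin_basis_ext)
  note l = linD[OF this(1)] linD[OF this(2)]
  have e: "euler (v n) = cscale (of_nat n) (v n)" "anti_euler (v n) = cscale (1 / of_nat n) (v n)"
    "euler rx = 0" "euler ry = 0" "euler w = 0" "anti_euler rx = 0" "anti_euler ry = 0" "anti_euler w = 0"
    for n
    by (simp_all add: euler_def anti_euler_def)
  show "euler (anti_euler p) = D p - cscale (coord p (E 1)) (v 0)"
    by (rule lin_eq_on_basis[where f = "\<lambda>p. euler (anti_euler p)"
          and f' = "\<lambda>p. D p - cscale (coord p (E 1)) (v 0)"])
      (auto intro!: linI simp: l e lookup_add rvec.scale_left_distrib rvec.scale_right_diff_distrib)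
  show "anti_euler (euler p) = D p - cscale (coord p (E 1)) (v 0)"
    by (rule lin_eq_on_basis[where f = "\<lambda>p. anti_euler (euler p)"
          and f' = "\<lambda>p. D p - cscale (coord p (E 1)) (v 0)"])
      (auto intro!: linI simp: l e lookup_add rvec.scale_left_distrib rvec.scale_right_diff_distrib)
qed

lemma D_anti_euler: "D (anti_euler p) = anti_euler p"
  by (rule lin_eq_on_basis[where f = "\<lambda>p. D (anti_euler p)" and f' = anti_euler])
    (auto intro!: linI simp: anti_euler_def linD[OF lin_basis_ext])

text \<open>
  The Euler operator kills constant terms, so a constant in its image is zero, and its kernel in
  \<open>V\<close> consists of the constants.
\<close>

lemma euler_eq_v0:
  assumes "euler p = cscale c (v 0)"
  shows "c = 0" "D p = cscale (coord p (E 1)) (v 0)"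
proof -
  have l: "lin euler" "lin anti_euler" by (simp_all add: euler_def anti_euler_def lin_basis_ext)
  have "anti_euler (euler p) = 0" using assms 
    by (simp add: linD[OF l(2)], simp add: anti_euler_def)
  then show D: "D p = cscale (coord p (E 1)) (v 0)" by (simp add: euler_inverse)
  have "euler p = euler (D p)"
    by (rule lin_eq_on_basis[where f = euler and f' = "\<lambda>p. euler (D p)"])
     (auto intro!: linI simp: linD[OF l(1)] l(1), simp_all add: euler_def linD[OF lin_basis_ext])
  also have "\<dots> = 0" unfolding D by (simp add: linD[OF l(1)], simp add: euler_def)
  finally have "coord (cscale c (v 0)) (E 1) = 0" using assms by simp
  then show "c = 0" by simp
qed

lemma commuting_eq_0:
  assumes "lin A" "\<And>n. A (v (Suc n)) = A (v n) \<bullet> w" "A (v 0) = 0"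
  shows "A (v n) = 0"
  by (induction n) (simp_all add: assms)

text \<open>
  \<open>A\<close> is multiplication by the polynomial \<open>p = A 1\<close>, and its commutator with the action of \<open>x\<close> is
  multiplication by \<open>z p'\<close>. Only the value at the monomial \<open>1\<close> is needed, since an operator that
  commutes with \<open>z\<close> is determined by it.
\<close>

lemma commutator_x_v0:
  assumes A: "lin A" and comm: "\<And>n. A (v (Suc n)) = A (v n) \<bullet> w" and V: "D (A (v 0)) = A (v 0)"
  shows "A (v 0) \<bullet> rx - A (v 0 \<bullet> rx) = euler (A (v 0))"
proof -
  have "A (((\<lambda>q. q \<bullet> w) ^^ n) (v 0)) = ((\<lambda>q. q \<bullet> w) ^^ n) (A (v 0))" for n
    unfolding pow_w_v by (induction n) (simp_all add: comm)
  then have "A (mult_b (v 0)) = mult_b (A (v 0))"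
    by (simp add: mult_b_def linD[OF A])
  then show ?thesis using V_br_x[of "A (v 0)"] v_br_x[of 0] by (simp add: V)
qed

text \<open>
  On the monomial \<open>1\<close> the element \<open>p x + q y + r e\<^sub>1\<close> acts as \<open>p b + q + r z\<close>. Comparison with its
  value at \<open>z\<close> isolates the contribution of the Euler operator and gives \<open>p = 0\<close>.
\<close>

lemma faithful:
  assumes "D u = 0" "v 0 \<bullet> u = 0" "v 1 \<bullet> u = 0"
  shows "u = 0"
proof -
  define p q r where "p = coord u X" and "q = coord u Y" and "r = coord u (E 0)"
  have u: "u = cscale p rx + cscale q ry + cscale r w"
    using decompose[of u] assms(1) by (simp add: p_def q_def r_def)
  have b1: "mult_b (v 1) = mult_b (v 0) \<bullet> w"
    by (simp add: mult_b_def pow_w_v linD[OF lin_br(1)])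
  have "v 1 \<bullet> u = (v 0 \<bullet> u) \<bullet> w + cscale p (v 1)"
    by (simp add: u v_br_x b1[unfolded One_nat_def] rvec.scale_right_distrib)
  then have "coord (cscale p (v 1)) (E 2) = 0" using assms by simp
  then have p: "p = 0" by simp
  have s: "cscale q (v 0) + cscale r (v 1) = 0" using assms(2) by (simp add: u p)
  have "q = 0" using arg_cong[OF s, of "\<lambda>z. coord z (E 1)"] by (simp add: lookup_add)
  moreover have "r = 0" using arg_cong[OF s, of "\<lambda>z. coord z (E 2)"] by (simp add: lookup_add)
  ultimately show ?thesis using p by (simp add: u)
qed

section \<open>Subtracting coboundaries\<close>

definition cobdry :: "(rvec \<Rightarrow> rvec) \<Rightarrow> rvec \<Rightarrow> rvec \<Rightarrow> rvec" where
  "cobdry f a b = f (a \<bullet> b) - f a \<bullet> b - a \<bullet> f b"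

abbreviation "Z2 \<equiv> ZL2 cscale (rbr t \<beta>)"
abbreviation "B2 \<equiv> BL2 cscale (rbr t \<beta>)"

interpretation R: leibniz_algebra cscale "rbr t \<beta>" by (rule leibniz_algebra_rbr)

lemma cocycleD:
  assumes "\<phi> \<in> Z2"
  shows "bilinear_map cscale \<phi>"
    "a \<bullet> \<phi> b c - \<phi> a b \<bullet> c + \<phi> a c \<bullet> b + \<phi> a (b \<bullet> c) - \<phi> (a \<bullet> b) c + \<phi> (a \<bullet> c) b = 0"
  using assms by (auto simp: ZL2_def)

lemma cobdry_in_BL2: "lin f \<Longrightarrow> cobdry f \<in> B2"
  using R.coboundary_in_ZL2[of f] by (auto simp: BL2_def ZL2_def cobdry_def[abs_def])

text \<open>
  This allows a cocycle to be improved one coboundary at a time.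
\<close>

lemma diff_cobdry:
  assumes "\<phi> \<in> Z2" "lin f"
  shows "(\<lambda>a b. \<phi> a b - cobdry f a b) \<in> Z2"
    "(\<lambda>a b. \<phi> a b - cobdry f a b) \<in> B2 \<Longrightarrow> \<phi> \<in> B2"
proof -
  interpret G: comm_group "ZL2_group cscale (rbr t \<beta>)" by (rule R.comm_group_ZL2)
  interpret S: subgroup B2 "ZL2_group cscale (rbr t \<beta>)" by (rule R.subgroup_BL2)
  have "lin (\<lambda>a. - f a)" using assms(2) by (auto intro!: linI simp: linD)
  then have "cobdry (\<lambda>a. - f a) \<in> B2" by (rule cobdry_in_BL2)
  then have "cobdry (\<lambda>a. - f a) \<in> Z2" using S.subset by (auto simp: ZL2_group_def)
  then have "(\<lambda>a b. \<phi> a b + cobdry (\<lambda>a. - f a) a b) \<in> Z2"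
    using G.m_closed[of \<phi> "cobdry (\<lambda>a. - f a)"] assms(1) by (simp add: ZL2_group_def)
  then show "(\<lambda>a b. \<phi> a b - cobdry f a b) \<in> Z2" by (simp add: cobdry_def algebra_simps)
  assume "(\<lambda>a b. \<phi> a b - cobdry f a b) \<in> B2"
  from S.m_closed[OF this cobdry_in_BL2[OF assms(2)]] show "\<phi> \<in> B2" by (simp add: ZL2_group_def)
qed

section \<open>Reduction to cochains of weight zero\<close>

text \<open>
  Invariance under \<open>D\<close> would be \<open>D (\<phi> a b) = \<phi> (D a) b + \<phi> a (D b)\<close>. The stronger condition
  also asks that \<open>\<phi>\<close> vanish when its second argument is in \<open>V\<close>, which for cocycles turns out to
  follow from invariance.
\<close>

definition weight_zero :: "(rvec \<Rightarrow> rvec \<Rightarrow> rvec) \<Rightarrow> bool" where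
  "weight_zero \<phi> \<longleftrightarrow> (\<forall>a b. \<phi> a (D b) = 0) \<and> (\<forall>a b. D (\<phi> a b) = \<phi> (D a) b)"

lemma weight_zero_diff_cobdry:
  assumes "weight_zero \<phi>" "\<And>a. f (D a) = D (f a)" "f 0 = 0"
  shows "weight_zero (\<lambda>a b. \<phi> a b - cobdry f a b)"
proof -
  have "cobdry f a (D b) = 0" for a b by (simp add: cobdry_def assms(2,3))
  moreover have "D (cobdry f a b) = cobdry f (D a) b" for a b
  proof -
    have "D (f (a \<bullet> b)) = f (D a \<bullet> b)" by (metis assms(2) D_br)
    then show ?thesis by (simp add: cobdry_def D_br[of _ b] D_br[of _ "f b"] assms(2))
  qed
  ultimately show ?thesis using assms(1) by (simp add: weight_zero_def)
qed

text \<open>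
  The cocycle identity with third argument \<open>y\<close> is Cartan's formula: it equates the Lie derivative
  of \<open>\<phi>\<close> along \<open>D\<close> with the coboundary of the operator \<open>\<phi>(\<cdot>, y)\<close>. If that operator commutes with
  \<open>D\<close>, its coboundary has weight zero, so the components of \<open>\<phi>\<close> of weight \<open>\<noteq> 0\<close>, on which the
  Lie derivative is invertible, have to vanish.
\<close>

lemma weight_zero_of_commute:
  assumes Z: "\<phi> \<in> Z2" and comm: "\<And>a. D (\<phi> a ry) = \<phi> (D a) ry"
  shows "weight_zero \<phi>"
proof -
  note B [simp] = bilinear_mapD[OF cocycleD(1)[OF Z]]
  note C = cocycleD(2)[OF Z]
  have y: "\<phi> a (D b) + \<phi> (D a) b - D (\<phi> a b) = \<phi> (a \<bullet> b) ry - a \<bullet> \<phi> b ry - \<phi> a ry \<bullet> b" for a b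
    using C[of a b ry] by (simp add: algebra_simps)
  have b: "a \<bullet> \<phi> (D c) ry = 0" for a c by (simp flip: comm)
  have r: "\<phi> a (D c) + \<phi> (D a) (D c) = D (\<phi> a (D c))" for a c
    using y[of a "D c"] by (simp add: b)
  \<comment> \<open>On \<open>V \<times> V\<close> the formula says \<open>2 \<phi> = D \<phi>\<close>, and \<open>D\<close> has eigenvalues \<open>0\<close> and \<open>1\<close> only.\<close>
  have VV: "\<phi> (D a) (D c) = 0" for a c
  proof -
    have e: "\<phi> (D a) (D c) + \<phi> (D a) (D c) = D (\<phi> (D a) (D c))" using r[of "D a" c] by simp
    have "D (\<phi> (D a) (D c)) = 0" using arg_cong[OF e, of D] by simp
    with e have "cscale 2 (\<phi> (D a) (D c)) = 0" by (metis rvec.scale_left_distrib rvec.scale_one one_add_one)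
    then show ?thesis by simp
  qed
  have aV: "D (\<phi> a (D c)) = \<phi> a (D c)" for a c using r[of a c] by (simp add: VV)
  have left: "p \<bullet> \<phi> a (D c) = 0" for p a c using br_D[of p "\<phi> a (D c)"] by (simp only: aV)
  \<comment> \<open>The component \<open>g \<times> V \<rightarrow> V\<close> has weight zero. It vanishes because \<open>[L, V] = 0\<close>, which leaves
      of the cocycle identity at \<open>(a, y, D c)\<close> only \<open>D (\<phi> a (D c)) = \<phi> (D a) (D c)\<close>.\<close>
  have 1: "\<phi> a (D c) = 0" for a c
    using C[of a ry "D c"] by (simp add: left aV VV)
  have "D (\<phi> a b) = \<phi> (D a) b" for a b
  proof -
    have e: "\<phi> (D a) b - D (\<phi> a b) = \<phi> (a \<bullet> b) ry - a \<bullet> \<phi> b ry - \<phi> a ry \<bullet> b" for a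
      using y[of a b] by (simp add: 1)
    have "D (\<phi> (D a) b) - D (\<phi> a b) = \<phi> (D a) b - D (\<phi> (D a) b)" for a
    proof -
      have "D (\<phi> (D a) b) - D (\<phi> a b)
          = \<phi> (D a \<bullet> b) ry - D a \<bullet> \<phi> b ry - \<phi> (D a) ry \<bullet> b"
        using arg_cong[OF e[of a], of D]
        by (simp add: comm D_br[of _ b] D_br[of _ "\<phi> b ry"])
      with e[of "D a"] show ?thesis by simp
    qed
    from this[of a] this[of "D a"] show ?thesis by simp
  qed
  with 1 show ?thesis by (simp add: weight_zero_def)
qed

text \<open>
  The commutator of \<open>\<phi>(\<cdot>, y)\<close> with \<open>D\<close> serves as \<open>f\<close>: the coboundary of \<open>f\<close> changes \<open>\<phi>(\<cdot>, y)\<close> by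
  the commutator of \<open>f\<close> with \<open>D\<close>. As \<open>D\<close> is a projection, this cancels the off-diagonal
  blocks of \<open>\<phi>(\<cdot>, y)\<close> with respect to \<open>L = g \<oplus> V\<close>.
\<close>

lemma reduce_to_weight_zero:
  assumes Z: "\<phi> \<in> Z2"
  obtains f where "lin f" "weight_zero (\<lambda>a b. \<phi> a b - cobdry f a b)"
proof -
  note B = bilinear_mapD[OF cocycleD(1)[OF Z]]
  define f where "f a = \<phi> (D a) ry - D (\<phi> a ry)" for a
  have lin: "lin f" by (rule linI) (simp_all add: f_def B rvec.scale_right_diff_distrib)
  have "weight_zero (\<lambda>a b. \<phi> a b - cobdry f a b)"
    by (rule weight_zero_of_commute[OF diff_cobdry(1)[OF Z lin]]) (simp add: cobdry_def f_def B)
  with lin show ?thesis by (rule that)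
qed

section \<open>Cocycles of weight zero are coboundaries\<close>

lemma bilinear_eq_0:
  assumes "bilinear_map cscale \<phi>"
    and "\<And>a b. a \<in> {rx, ry, w} \<union> range v \<Longrightarrow> b \<in> {rx, ry, w} \<union> range v \<Longrightarrow> \<phi> a b = 0"
  shows "\<phi> = (\<lambda>a b. 0)"
proof (intro ext)
  note B = bilinear_mapD[OF assms(1)]
  fix a b
  have 1: "\<phi> a b = 0" if "a \<in> {rx, ry, w} \<union> range v" for a
    by (rule lin_eq_on_basis[where f = "\<phi> a" and f' = "\<lambda>_. 0"]; (rule linI; simp add: B)?)
      (use assms(2) that in auto)
  show "\<phi> a b = 0"
    by (rule lin_eq_on_basis[where f = "\<lambda>a. \<phi> a b" and f' = "\<lambda>_. 0"]; (rule linI; simp add: B)?)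
      (use 1 in auto)
qed

text \<open>
  In the cocycle identity for \<open>(v, c, c)\<close> the terms that are antisymmetric in the last two
  arguments cancel and \<open>[c, c] = 0\<close>, which leaves \<open>[v, \<phi>(c, c)] = 0\<close> for all \<open>v \<in> V\<close>. As
  \<open>\<phi>(c, c)\<close> lies in \<open>g\<close>, faithfulness applies.
\<close>

lemma weight_zero_diagonal:
  assumes Z: "\<phi> \<in> Z2" and wz: "weight_zero \<phi>" and g: "D c = 0"
  shows "\<phi> c c = 0"
proof (rule faithful)
  note B = bilinear_mapD[OF cocycleD(1)[OF Z]]
  show "D (\<phi> c c) = 0" using wz g by (simp add: weight_zero_def B)
  define p q r where "p = coord c X" and "q = coord c Y" and "r = coord c (E 0)"
  have c: "c = cscale p rx + cscale q ry + cscale r w"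
    using decompose[of c] g by (simp add: p_def q_def r_def)
  have "c \<bullet> c = 0" unfolding c by (simp add: rvec.scale_left_commute mult.commute)
  then have "v n \<bullet> \<phi> c c = 0" for n using cocycleD(2)[OF Z, of "v n" c c] by (simp add: B)
  then show "v 0 \<bullet> \<phi> c c = 0" "v 1 \<bullet> \<phi> c c = 0" by simp_all
qed

lemma weight_zero_alternating:
  assumes Z: "\<phi> \<in> Z2" and wz: "weight_zero \<phi>" and g: "D a = 0" "D b = 0"
  shows "\<phi> b a = - \<phi> a b"
proof -
  have "\<phi> (a + b) (a + b) = 0" by (rule weight_zero_diagonal[OF Z wz]) (simp add: g)
  then show ?thesis
    by (simp add: bilinear_mapD[OF cocycleD(1)[OF Z]] weight_zero_diagonal[OF Z wz] g add.commute
        eq_neg_iff_add_eq_0)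
qed

text \<open>
  The values of \<open>f\<close> on \<open>x, y, e\<^sub>1\<close> remove all of \<open>\<phi>(e\<^sub>1, x)\<close> and the \<open>e\<^sub>1\<close>-components of
  \<open>\<phi>(e\<^sub>1, y)\<close> and \<open>\<phi>(x, y)\<close>. On \<open>V\<close>, the condition \<open>\<psi>(v\<^sub>n, e\<^sub>1) = 0\<close> prescribes \<open>f(v\<^sub>n\<^sub>+\<^sub>1)\<close> in terms of
  \<open>f(v\<^sub>n)\<close>, hence is solved by recursion from \<open>f(v\<^sub>0) = 0\<close>.
\<close>

lemma kill_w_components:
  assumes Z: "\<phi> \<in> Z2" and wz: "weight_zero \<phi>"
  obtains f \<psi> a where "lin f" "\<psi> = (\<lambda>a b. \<phi> a b - cobdry f a b)" "weight_zero \<psi>"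
    "\<psi> w rx = 0" "\<psi> w ry = 0" "\<psi> rx ry = cscale a ry" "\<And>n. \<psi> (v n) w = 0"
proof -
  have D0: "D (\<phi> a b) = 0" if "D a = 0" for a b
    using wz that bilinear_mapD(7)[OF cocycleD(1)[OF Z]] by (simp add: weight_zero_def)
  define fw where "fw = cscale (coord (\<phi> w rx) X) rx + cscale (coord (\<phi> w rx) Y) ry"
  define fv where "fv = rec_nat 0 (\<lambda>n r. \<phi> (v n) w + r \<bullet> w + v n \<bullet> fw)"
  define f where "f = basis_ext (cscale (- coord (\<phi> w rx) (E 0)) rx)
    (cscale (- coord (\<phi> w ry) (E 0)) rx + cscale (coord (\<phi> rx ry) (E 0)) w) fw fv"
  have lin: "lin f" unfolding f_def by (rule lin_basis_ext)
  have f: "f rx = cscale (- coord (\<phi> w rx) (E 0)) rx" "f w = fw" "f (v n) = fv n"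
    "f ry = cscale (- coord (\<phi> w ry) (E 0)) rx + cscale (coord (\<phi> rx ry) (E 0)) w" for n
    by (simp_all add: f_def)
  have V: "D (fv n) = fv n" for n
  proof (induction n)
    case (Suc n)
    have "D (\<phi> (v n) w) = \<phi> (v n) w" using wz by (simp add: weight_zero_def)
    moreover have "D (v n \<bullet> fw) = v n \<bullet> fw" using D_br[of "v n" fw] by simp
    ultimately show ?case using Suc D_br[of "fv n" w] by (simp add: fv_def)
  qed (simp add: fv_def)
  have fD: "f (D a) = D (f a)" for a
    by (rule lin_eq_on_basis[where f = "\<lambda>a. f (D a)" and f' = "\<lambda>a. D (f a)"])
      (auto intro!: linI simp: linD[OF lin] f V fw_def)
  define \<psi> where "\<psi> = (\<lambda>a b. \<phi> a b - cobdry f a b)"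
  have Z': "\<psi> \<in> Z2" unfolding \<psi>_def by (rule diff_cobdry(1)[OF Z lin])
  have wz': "weight_zero \<psi>" unfolding \<psi>_def
    by (rule weight_zero_diff_cobdry[OF wz]) (simp_all add: fD linD[OF lin])
  note dec = decompose[of "\<phi> w rx"] decompose[of "\<phi> w ry"] decompose[of "\<phi> rx ry"]
  have wx: "\<psi> w rx = 0"
    using dec(1) by (simp add: \<psi>_def cobdry_def f fw_def D0)
  have wy: "\<psi> w ry = cscale (coord (\<phi> w ry) X) rx + cscale (coord (\<phi> w ry) Y) ry"
    using dec(2) by (simp add: \<psi>_def cobdry_def f fw_def D0 linD[OF lin] diff_eq_eq)
  have xy: "\<psi> rx ry = cscale (coord (\<phi> rx ry) X) rx + cscale (coord (\<phi> rx ry) Y) ry"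
    using dec(3) by (simp add: \<psi>_def cobdry_def f fw_def D0 linD[OF lin] diff_eq_eq)
  have vw: "\<psi> (v n) w = 0" for n
    by (simp add: \<psi>_def cobdry_def f fv_def)
  \<comment> \<open>The cocycle identity at \<open>(e\<^sub>1, x, y)\<close> rules out all other components.\<close>
  have s: "cscale (coord (\<phi> rx ry) X) w - \<psi> w ry = 0"
    using cocycleD(2)[OF Z', of w rx ry] wx by (simp add: wy xy bilinear_mapD[OF cocycleD(1)[OF Z']])
  have 1: "coord (\<phi> rx ry) X = 0"
    using arg_cong[OF s, of "\<lambda>z. coord z (E 0)"] by (simp add: wy lookup_add lookup_minus)
  with s have "\<psi> w ry = 0" by simp
  moreover from xy 1 have "\<psi> rx ry = cscale (coord (\<phi> rx ry) Y) ry" by simp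
  ultimately show thesis by (intro that[OF lin \<psi>_def wz' wx _ _ vw])
qed

text \<open>
  These are the cocycle identities at \<open>(v\<^sub>n, e\<^sub>1, x)\<close> and \<open>(v\<^sub>n, e\<^sub>1, y)\<close>, in which every other term
  vanishes.
\<close>

lemma commute_with_w:
  assumes Z: "\<phi> \<in> Z2" and "\<phi> w rx = 0" "\<phi> w ry = 0" "\<And>n. \<phi> (v n) w = 0"
  shows "\<phi> (v (Suc n)) rx = \<phi> (v n) rx \<bullet> w" "\<phi> (v (Suc n)) ry = \<phi> (v n) ry \<bullet> w"
proof -
  note B = bilinear_mapD[OF cocycleD(1)[OF Z]]
  have "\<phi> (D p) w = 0" for p
    by (rule lin_eq_on_basis[where f = "\<lambda>p. \<phi> (D p) w" and f' = "\<lambda>_. 0"])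
      (auto intro!: linI simp: B assms)
  from this[of "v n \<bullet> rx"] have "\<phi> (v n \<bullet> rx) w = 0" by (simp add: D_br[of _ rx])
  then show "\<phi> (v (Suc n)) rx = \<phi> (v n) rx \<bullet> w"
    using cocycleD(2)[OF Z, of "v n" w rx] by (simp add: assms B)
  show "\<phi> (v (Suc n)) ry = \<phi> (v n) ry \<bullet> w"
    using cocycleD(2)[OF Z, of "v n" w ry] by (simp add: assms B)
qed

lemma normalized_eq_0:
  assumes Z: "\<phi> \<in> Z2" and wz: "weight_zero \<phi>"
    and H: "\<phi> w rx = 0" "\<phi> w ry = 0" "\<phi> rx ry = 0" "\<And>n. \<phi> (v n) w = 0"
    and H0: "\<phi> (v 0) rx = 0" "\<phi> (v 0) ry = 0"
  shows "\<phi> = (\<lambda>a b. 0)"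
proof (rule bilinear_eq_0[OF cocycleD(1)[OF Z]])
  note B = bilinear_mapD[OF cocycleD(1)[OF Z]]
  note alt = weight_zero_alternating[OF Z wz]
  have right: "\<phi> a (v n) = 0" for a n
    using wz v_br_y[of n] unfolding weight_zero_def by metis
  have left: "\<phi> (v n) rx = 0" "\<phi> (v n) ry = 0" for n
    by (rule commuting_eq_0[of "\<lambda>a. \<phi> a rx"] commuting_eq_0[of "\<lambda>a. \<phi> a ry"];
        (rule linI)?; simp add: B commute_with_w[OF Z H(1,2,4)] H0)+
  have "\<phi> rx w = 0" "\<phi> ry w = 0" "\<phi> ry rx = 0" "\<phi> rx rx = 0" "\<phi> ry ry = 0" "\<phi> w w = 0"
    using alt[of w rx] alt[of w ry] alt[of rx ry]
    by (simp_all add: H weight_zero_diagonal[OF Z wz])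
  then show "\<phi> a b = 0"
    if "a \<in> {rx, ry, w} \<union> range v" "b \<in> {rx, ry, w} \<union> range v" for a b
    using that by (auto simp: H left right)
qed

text \<open>
  The one nontrivial class of \<open>g\<close> dies here: the cocycle identity at \<open>(1, x, y)\<close>, with
  \<open>1 \<in> V\<close>, equates its coefficient \<open>a\<close> up to sign with a polynomial of the form \<open>z p'\<close>. The map \<open>f\<close>
  that kills the rest is multiplication by a polynomial on \<open>V\<close> and sends \<open>x\<close> and \<open>y\<close> to
  multiples of the central element \<open>y\<close>.
\<close>

lemma normalized_in_BL2:
  assumes Z: "\<phi> \<in> Z2" and wz: "weight_zero \<phi>"
    and H: "\<phi> w rx = 0" "\<phi> w ry = 0" "\<phi> rx ry = cscale a ry" "\<And>n. \<phi> (v n) w = 0"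
  shows "\<phi> \<in> B2"
proof -
  note B = bilinear_mapD[OF cocycleD(1)[OF Z]]
  note comm = commute_with_w[OF Z H(1,2,4)]
  have V: "D (\<phi> (v n) b) = \<phi> (v n) b" for n b using wz by (simp add: weight_zero_def)
  have "\<phi> (v 0) ry \<bullet> rx - \<phi> (v 0 \<bullet> rx) ry = euler (\<phi> (v 0) ry)"
    by (rule commutator_x_v0[of "\<lambda>p. \<phi> p ry"]) (auto intro!: linI simp: B comm V)
  moreover have "\<phi> (v 0) ry \<bullet> rx - \<phi> (v 0 \<bullet> rx) ry = cscale (- a) (v 0)"
    using cocycleD(2)[OF Z, of "v 0" rx ry] by (simp add: H V B algebra_simps add_eq_0_iff)
  ultimately have e: "euler (\<phi> (v 0) ry) = cscale (- a) (v 0)" by simp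
  define c where "c = coord (\<phi> (v 0) ry) (E 1)"
  have a: "a = 0" and Ay: "\<phi> (v 0) ry = cscale c (v 0)"
    using euler_eq_v0[OF e] by (simp_all add: V c_def)
  define q where "q = \<phi> (v 0) rx"
  \<comment> \<open>Solves \<open>z p' = q(0) - q\<close>, so that multiplication by \<open>p\<close> reduces \<open>\<phi>(1, x) = q\<close> to its constant term.\<close>
  define p where "p = - anti_euler q"
  have Dp: "D p = p" by (simp add: p_def D_anti_euler)
  have "lin euler" by (simp add: euler_def lin_basis_ext)
  then have ep: "euler p = cscale (coord q (E 1)) (v 0) - q"
    by (simp add: p_def linD euler_inverse q_def V)
  define f where "f = basis_ext (cscale (- coord q (E 1)) ry) (cscale (- c) ry) 0
    (\<lambda>n. ((\<lambda>q. q \<bullet> w) ^^ n) p)"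
  have lin: "lin f" unfolding f_def by (rule lin_basis_ext)
  have f: "f rx = cscale (- coord q (E 1)) ry" "f ry = cscale (- c) ry" "f w = 0"
    "f (v n) = ((\<lambda>q. q \<bullet> w) ^^ n) p" for n by (simp_all add: f_def)
  have fV: "D (f (v n)) = f (v n)" for n
    unfolding f using D_br[of _ w] by (induction n) (simp_all add: Dp)
  have fD: "f (D a) = D (f a)" for a
    by (rule lin_eq_on_basis[where f = "\<lambda>a. f (D a)" and f' = "\<lambda>a. D (f a)"])
      (use fV in \<open>auto intro!: linI simp: linD[OF lin] f\<close>)
  define \<psi> where "\<psi> = (\<lambda>a b. \<phi> a b - cobdry f a b)"
  have "\<psi> = (\<lambda>a b. 0)"
  proof (rule normalized_eq_0)
    show "\<psi> \<in> Z2" unfolding \<psi>_def by (rule diff_cobdry(1)[OF Z lin])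
    show "weight_zero \<psi>" unfolding \<psi>_def
      by (rule weight_zero_diff_cobdry[OF wz]) (simp_all add: fD linD[OF lin])
    show "\<psi> w rx = 0" "\<psi> w ry = 0" "\<psi> rx ry = 0" "\<psi> (v n) w = 0" for n
      by (simp_all add: \<psi>_def cobdry_def f H a linD[OF lin])
    show "\<psi> (v 0) ry = 0" by (simp add: \<psi>_def cobdry_def f Ay Dp)
    have "p \<bullet> rx - f (v 0 \<bullet> rx) = euler p"
      using commutator_x_v0[OF lin] fV[of 0] by (simp add: f)
    then show "\<psi> (v 0) rx = 0"
      by (simp add: \<psi>_def cobdry_def f ep algebra_simps flip: q_def)
  qed
  moreover have "(\<lambda>a b. 0) \<in> B2"
    using subgroup.one_closed[OF R.subgroup_BL2] by (simp add: ZL2_group_def)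
  ultimately show ?thesis using diff_cobdry(2)[OF Z lin] by (simp add: \<psi>_def)
qed

lemma ZL2_eq_BL2: "Z2 = B2"
proof
  show "B2 \<subseteq> Z2" using subgroup.subset[OF R.subgroup_BL2] by (simp add: ZL2_group_def)
  show "Z2 \<subseteq> B2"
  proof
    fix \<phi> assume Z: "\<phi> \<in> Z2"
    obtain f where f: "lin f" and wz: "weight_zero (\<lambda>a b. \<phi> a b - cobdry f a b)"
      by (rule reduce_to_weight_zero[OF Z])
    note Z1 = diff_cobdry(1)[OF Z f]
    obtain g \<psi> a where g: "lin g" "\<psi> = (\<lambda>a b. \<phi> a b - cobdry f a b - cobdry g a b)"
      and n: "weight_zero \<psi>" "\<psi> w rx = 0" "\<psi> w ry = 0" "\<psi> rx ry = cscale a ry"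
        "\<And>n. \<psi> (v n) w = 0"
      by (rule kill_w_components[OF Z1 wz]) blast
    have "\<psi> \<in> Z2" unfolding g(2) by (rule diff_cobdry(1)[OF Z1 g(1)])
    from normalized_in_BL2[OF this n] show "\<phi> \<in> B2"
      unfolding g(2) by (intro diff_cobdry(2)[OF Z f] diff_cobdry(2)[OF Z1 g(1)])
  qed
qed

end

theorem theorem3p12:
  fixes t :: nat and \<beta> :: "nat \<Rightarrow> complex"
  shows "trivial_group (HL2 cscale (rbr t \<beta>))"
proof -
  interpret R: leibniz_algebra cscale "rbr t \<beta>" by (rule leibniz_algebra_rbr)
  interpret G: comm_group "ZL2_group cscale (rbr t \<beta>)" by (rule R.comm_group_ZL2)
  have "BL2 cscale (rbr t \<beta>) = carrier (ZL2_group cscale (rbr t \<beta>))"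
    by (simp add: ZL2_group_def ZL2_eq_BL2)
  then have "carrier (HL2 cscale (rbr t \<beta>)) = {\<one>\<^bsub>HL2 cscale (rbr t \<beta>)\<^esub>}"
    using G.coset_join2[OF _ G.subgroup_self] G.one_closed
    by (auto simp: HL2_def carrier_FactGroup)
  with R.group_HL2 show ?thesis by (simp add: trivial_group_def)
qed

end
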